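(* Let $l$ be a positive integer and $U=U(P,Q)$ a $\Delta$-regular Lucas sequence. Let $p$ be a prime with $p\nmid Q$ and $\rho_U(p)>l$. Then $v_p(C_{U,l}(n))\geq 0$ for all integers $n\geq1$, where \[ C_{U,l}(n)=\frac{1}{U_{n+1}^l}\cdot\frac{((l+1)n)!_U}{(n!_U)^{l+1}}. \]
   Context: For nonzero integers $P,Q$, $U=U(P,Q)$ is defined by $U_0=0$, $U_1=1$, $U_{n+2}=PU_{n+1}-QU_n$; $\Delta=P^2-4Q$. $U$ is $\Delta$-regular if $U_n\neq0$ for all $n\geq1$, $\gcd(P,Q)=1$ and $\Delta\neq0$. For a prime $p\nmid Q$, the rank of appearance $\rho_U(p)$ is the least integer $n\geq1$ with $p\mid U_n$ (it exists). $n!_U=U_n\cdots U_1$ and $0!_U=1$. $v_p$ is the $p$-adic valuation (extended to nonzero rationals). *)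

theory Defs
  imports Complex_Main "HOL-Computational_Algebra.Primes"
begin

fun lucas :: "int \<Rightarrow> int \<Rightarrow> nat \<Rightarrow> int" where
  "lucas P Q 0 = 0"
| "lucas P Q (Suc 0) = 1"
| "lucas P Q (Suc (Suc n)) = P * lucas P Q (Suc n) - Q * lucas P Q n"

definition lucas_disc :: "int \<Rightarrow> int \<Rightarrow> int" where
  "lucas_disc P Q = P ^ 2 - 4 * Q"

definition delta_regular :: "int \<Rightarrow> int \<Rightarrow> bool" where
  "delta_regular P Q \<longleftrightarrow>
     P \<noteq> 0 \<and> Q \<noteq> 0 \<and> (\<forall>n\<ge>1. lucas P Q n \<noteq> 0) \<and> gcd P Q = 1 \<and> lucas_disc P Q \<noteq> 0"

text \<open>Only meaningful if some such index exists, which is the case for primes not dividing \<open>Q\<close>.\<close>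

definition rank_of_appearance :: "int \<Rightarrow> int \<Rightarrow> nat \<Rightarrow> nat" where
  "rank_of_appearance P Q p = (LEAST n. 1 \<le> n \<and> int p dvd lucas P Q n)"

definition lucas_fact :: "int \<Rightarrow> int \<Rightarrow> nat \<Rightarrow> int" where
  "lucas_fact P Q n = (\<Prod>i=1..n. lucas P Q i)"

definition lucas_C :: "int \<Rightarrow> int \<Rightarrow> nat \<Rightarrow> nat \<Rightarrow> rat" where
  "lucas_C P Q l n =
     1 / of_int (lucas P Q (n + 1)) ^ l
       * (of_int (lucas_fact P Q ((l + 1) * n)) / of_int (lucas_fact P Q n) ^ (l + 1))"

text \<open>The \<open>p\<close>-adic valuation of a nonzero rational; the value at \<open>0\<close> is a dummy.\<close>

definition padic_val :: "nat \<Rightarrow> rat \<Rightarrow> int" where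
  "padic_val p r =
     (let (a, b) = quotient_of r in int (multiplicity (int p) a) - int (multiplicity (int p) b))"

end

theory Submission
  imports Defs
begin

text \<open>
  Fix \<open>k \<ge> 1\<close>. As \<open>p\<close> does not divide \<open>Q\<close>, the positive indices \<open>m\<close> with \<open>p ^ k\<close> dividing \<open>U\<^sub>m\<close> are
  the multiples of some \<open>r\<close>, or there are none; moreover \<open>r > l\<close>. By Legendre's counting
  argument, \<open>k\<close> contributes
  \<open>\<lfloor>(l + 1) n / r\<rfloor> - (l + 1) \<lfloor>n / r\<rfloor> - l [r | n + 1]\<close> to the valuation of \<open>C(n)\<close>.
  If \<open>r\<close> does not divide \<open>n + 1\<close> this is nonnegative by superadditivity of the floor. If
  \<open>n + 1 = q r\<close>, then \<open>l < r\<close> gives \<open>\<lfloor>(l + 1) n / r\<rfloor> = (l + 1) q - 1\<close>, so the contribution is \<open>0\<close>.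
\<close>

lemma lucas_add:
  "lucas P Q (Suc (m + n)) = lucas P Q (Suc m) * lucas P Q (Suc n) - Q * lucas P Q m * lucas P Q n"
proof (induction m arbitrary: n)
  case (Suc m)
  \<comment> \<open>The hypothesis at \<open>Suc n\<close> moves one unit from \<open>m\<close> to
    \<open>n\<close>; the recurrence then rewrites both \<open>U (n + 2)\<close> and
    \<open>U (m + 2)\<close>.\<close>
  from Suc[of "Suc n"] show ?case by (simp add: algebra_simps)
qed simp

text \<open>Since \<open>p\<close> is prime to \<open>Q\<close>, the recurrence runs backwards
  modulo \<open>p\<close>: a common divisor of two neighbours would descend to
  \<open>U 1 = 1\<close>.\<close>

lemma not_dvd_consecutive_lucas:
  assumes "prime p" "\<not> p dvd Q"
  shows "\<not> (p dvd lucas P Q n \<and> p dvd lucas P Q (Suc n))"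
proof (induction n)
  case 0
  show ?case using assms by auto
next
  case (Suc n)
  show ?case
  proof
    assume h: "p dvd lucas P Q (Suc n) \<and> p dvd lucas P Q (Suc (Suc n))"
    then have "p dvd P * lucas P Q (Suc n) - lucas P Q (Suc (Suc n))"
      by (meson dvd_diff dvd_mult)
    then have "p dvd Q * lucas P Q n" by simp
    with assms have "p dvd lucas P Q n" by (simp add: prime_dvd_mult_iff)
    with h Suc show False by blast
  qed
qed

text \<open>Modulo \<open>p ^ k\<close> the addition formula reduces to
  \<open>U (m + r + 1) = - Q * U r * U m\<close>, and \<open>Q * U r\<close> is a unit because
  \<open>p\<close> already divides the neighbour \<open>U (r + 1)\<close>.\<close>

lemma prime_power_dvd_lucas_add_iff:
  assumes p: "prime p" "\<not> p dvd Q" and k: "k \<ge> 1" and r: "p ^ k dvd lucas P Q (Suc r)"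
  shows "p ^ k dvd lucas P Q (m + Suc r) \<longleftrightarrow> p ^ k dvd lucas P Q m"
proof -
  have "p dvd lucas P Q (Suc r)" using dvd_trans[OF dvd_power] r k by auto
  then have "\<not> p dvd Q * lucas P Q r"
    using not_dvd_consecutive_lucas[OF p] p by (auto simp: prime_dvd_mult_iff)
  then have cop: "coprime (p ^ k) (Q * lucas P Q r)"
    using p prime_imp_coprime coprime_power_left_iff by blast
  have eq: "lucas P Q (m + Suc r)
      = lucas P Q (Suc m) * lucas P Q (Suc r) - (Q * lucas P Q r) * lucas P Q m"
    using lucas_add[of P Q m r] by (simp add: algebra_simps)
  have "p ^ k dvd lucas P Q (m + Suc r) \<longleftrightarrow> p ^ k dvd (Q * lucas P Q r) * lucas P Q m"
    unfolding eq using r by (metis dvd_diff dvd_diff_right_iff dvd_mult)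
  also have "\<dots> \<longleftrightarrow> p ^ k dvd lucas P Q m"
    using cop by (rule coprime_dvd_mult_right_iff)
  finally show ?thesis .
qed

text \<open>Subtracting \<open>r\<close> changes neither side, so everything reduces to indices
  below \<open>r\<close>, where minimality leaves only \<open>m = 0\<close>, with
  \<open>U 0 = 0\<close>.\<close>

lemma prime_power_dvd_lucas_iff:
  assumes p: "prime p" "\<not> p dvd Q" and k: "k \<ge> 1"
    and r: "r \<ge> 1" "p ^ k dvd lucas P Q r"
    and least: "\<And>m. m \<ge> 1 \<Longrightarrow> p ^ k dvd lucas P Q m \<Longrightarrow> r \<le> m"
  shows "p ^ k dvd lucas P Q m \<longleftrightarrow> r dvd m"
proof (induction m rule: less_induct)
  case (less m)
  show ?case
  proof (cases "m < r")
    case True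
    then show ?thesis using least[of m] r by (cases "m = 0") (auto dest: dvd_imp_le)
  next
    case False
    obtain s where s: "r = Suc s" using r by (cases r) auto
    have "p ^ k dvd lucas P Q m \<longleftrightarrow> p ^ k dvd lucas P Q (m - r)"
      using prime_power_dvd_lucas_add_iff[OF p k, of P s "m - r"] r False s by simp
    also have "\<dots> \<longleftrightarrow> r dvd m - r" using less[of "m - r"] False r by simp
    also have "\<dots> \<longleftrightarrow> r dvd m" using False by (simp add: dvd_minus_self)
    finally show ?thesis .
  qed
qed

lemma card_multiples:
  assumes "r \<ge> (1::nat)"
  shows "card {i\<in>{1..m}. r dvd i} = m div r"
proof -
  have "{i\<in>{1..m}. r dvd i} = (\<lambda>j. r * j) ` {1..m div r}"
  proof (intro equalityI subsetI)
    fix i assume "i \<in> {i\<in>{1..m}. r dvd i}"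
    then obtain j where "i = r * j" "1 \<le> r * j" "r * j \<le> m" by auto
    moreover from this have "j \<le> m div r" "1 \<le> j"
      using assms by (auto simp: less_eq_div_iff_mult_less_eq mult.commute intro: Suc_leI gr0I)
    ultimately show "i \<in> (\<lambda>j. r * j) ` {1..m div r}" by auto
  next
    fix i assume "i \<in> (\<lambda>j. r * j) ` {1..m div r}"
    then show "i \<in> {i\<in>{1..m}. r dvd i}"
      using assms by (auto simp: less_eq_div_iff_mult_less_eq mult.commute)
  qed
  then show ?thesis using assms by (simp add: card_image inj_on_def)
qed

lemma div_contribution_le:
  assumes "l < (r::nat)"
  shows "l * of_bool (r dvd Suc n) + (l + 1) * (n div r) \<le> ((l + 1) * n) div r"
proof (cases "r dvd Suc n")
  case False
  have "((l + 1) * (n div r)) * r \<le> (l + 1) * n"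
    by (metis div_times_less_eq_dividend mult.assoc mult_le_mono2)
  then have "(l + 1) * (n div r) \<le> ((l + 1) * n) div r"
    using assms by (subst less_eq_div_iff_mult_less_eq) auto
  then show ?thesis using False by simp
next
  case True
  then obtain q' where q': "Suc n = r * q'" by auto
  \<comment> \<open>The cofactor is positive, so \<open>n\<close> leaves the largest possible
    remainder \<open>r - 1\<close> on division by \<open>r\<close>.\<close>
  then obtain q where q: "Suc n = r * Suc q" by (cases q') auto
  then have n: "n = (r - 1) + r * q" using assms by (cases r) auto
  have "n div r = q" using assms q by (intro div_nat_eqI) (auto simp: n mult.commute)
  \<comment> \<open>After cancelling \<open>(l + 1) * q * r\<close> this reads
    \<open>l * r \<le> (l + 1) * (r - 1)\<close>, which is equivalent to
    \<open>l < r\<close>.\<close>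
  moreover have "(l + (l + 1) * q) * r \<le> (l + 1) * n"
  proof -
    obtain s where s: "r = Suc s" "l \<le> s" using assms by (cases r) auto
    have "l * r \<le> (l + 1) * s" using s by simp
    then show ?thesis unfolding n using s by (simp add: algebra_simps)
  qed
  then have "l + (l + 1) * q \<le> ((l + 1) * n) div r"
    using assms by (subst less_eq_div_iff_mult_less_eq) auto
  ultimately show ?thesis using True by simp
qed

lemma card_prime_power_dvd_lucas_le:
  assumes p: "prime p" "\<not> p dvd Q" and k: "k \<ge> 1"
    and rank: "\<And>m. m \<ge> 1 \<Longrightarrow> p dvd lucas P Q m \<Longrightarrow> l < m"
  shows "l * of_bool (p ^ k dvd lucas P Q (Suc n)) + (l + 1) * card {i\<in>{1..n}. p ^ k dvd lucas P Q i}
    \<le> card {i\<in>{1..(l + 1) * n}. p ^ k dvd lucas P Q i}"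
proof (cases "\<exists>m\<ge>1. p ^ k dvd lucas P Q m")
  case False
  then have "{i\<in>{1..n}. p ^ k dvd lucas P Q i} = {}" "\<not> p ^ k dvd lucas P Q (Suc n)" by auto
  then show ?thesis by (simp only: of_bool_eq card.empty)
next
  case True
  define r where "r = (LEAST m. m \<ge> 1 \<and> p ^ k dvd lucas P Q m)"
  have r: "r \<ge> 1" "p ^ k dvd lucas P Q r"
    using LeastI_ex[of "\<lambda>m. m \<ge> 1 \<and> p ^ k dvd lucas P Q m"] True by (auto simp: r_def)
  have iff: "p ^ k dvd lucas P Q m \<longleftrightarrow> r dvd m" for m
    by (rule prime_power_dvd_lucas_iff[OF p k r]) (auto simp: r_def intro: Least_le)
  \<comment> \<open>The bound on the rank of \<open>p\<close> carries over to \<open>p ^ k\<close>,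
    whose multiples are multiples of \<open>p\<close>.\<close>
  have "p dvd lucas P Q r" using dvd_trans[OF dvd_power r(2)] k by auto
  then have "l < r" using rank r by blast
  then show ?thesis
    using div_contribution_le[of l r n] r unfolding iff card_multiples[OF r(1)] by simp
qed

text \<open>The cutoff \<open>K\<close> may be any upper bound, so that one \<open>K\<close> can
  serve many terms at once.\<close>

lemma multiplicity_eq_sum_of_bool:
  fixes p x :: int
  assumes "prime p" "x \<noteq> 0" "multiplicity p x \<le> K"
  shows "multiplicity p x = (\<Sum>k=1..K. of_bool (p ^ k dvd x))"
proof -
  have iff: "p ^ k dvd x \<longleftrightarrow> k \<le> multiplicity p x" for k
    using assms by (intro power_dvd_iff_le_multiplicity) auto
  have "{1..K} \<inter> {k. p ^ k dvd x} = {1..multiplicity p x}"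
    unfolding iff using assms(3) by auto
  then show ?thesis by simp
qed

text \<open>\<open>padic_val\<close> reads off the reduced fraction \<open>c / d\<close>;
  cross-multiplying to \<open>a * d = c * b\<close> shows that any other fraction gives the same
  difference of multiplicities.\<close>

lemma padic_val_divide_nonneg:
  assumes p: "prime p" and ab: "a \<noteq> 0" "b \<noteq> 0"
    and le: "multiplicity (int p) b \<le> multiplicity (int p) a"
  shows "padic_val p (of_int a / of_int b) \<ge> 0"
proof -
  obtain c d where cd: "quotient_of (of_int a / of_int b) = (c, d)" by fastforce
  then have d: "d > 0" by (rule quotient_of_denom_pos)
  have "(of_int a / of_int b :: rat) = of_int c / of_int d" using cd by (rule quotient_of_div)
  then have "(of_int (a * d) :: rat) = of_int (c * b)" using ab d by (simp add: field_simps)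
  then have eq: "a * d = c * b" by linarith
  then have c: "c \<noteq> 0" using ab d by auto
  have "prime_elem (int p)" using p by simp
  then have "multiplicity (int p) a + multiplicity (int p) d
      = multiplicity (int p) c + multiplicity (int p) b"
    using eq ab c d prime_elem_multiplicity_mult_distrib
    by (metis less_irrefl)
  then show ?thesis using le by (simp add: padic_val_def cd)
qed

theorem theorem19:
  fixes P Q :: int and l p :: nat
  assumes "l \<ge> 1"
    and "delta_regular P Q"
    and "prime p"
    and "\<not> int p dvd Q"
    and "rank_of_appearance P Q p > l"
  shows "\<forall>n\<ge>1. padic_val p (lucas_C P Q l n) \<ge> 0"
proof (intro allI impI)
  fix n :: nat
  let ?v = "multiplicity (int p)" and ?U = "lucas P Q"
  have p: "prime (int p)" using assms by simp
  then have pe: "prime_elem (int p)" by simp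
  have nz: "?U i \<noteq> 0" if "i \<ge> 1" for i
    using assms that by (auto simp: delta_regular_def)
  have fnz: "lucas_fact P Q m \<noteq> 0" for m
    using nz by (auto simp: lucas_fact_def)
  have rank: "l < m" if "m \<ge> 1" "int p dvd ?U m" for m
    using assms(5) Least_le[of "\<lambda>n. 1 \<le> n \<and> int p dvd ?U n" m] that
    by (simp add: rank_of_appearance_def)
  \<comment> \<open>\<open>N\<close> bounds all the indices involved, namely \<open>n\<close>,
    \<open>n + 1\<close> and \<open>(l + 1) * n\<close>, and \<open>K\<close> bounds the valuations
    of all terms up to \<open>N\<close>.\<close>
  define N where "N = (l + 1) * n + n + 1"
  define K where "K = Max (?v ` ?U ` {1..N})"
  have vsum: "?v (?U i) = (\<Sum>k=1..K. of_bool (int p ^ k dvd ?U i))" if "i \<in> {1..N}" for i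
    using that p nz by (intro multiplicity_eq_sum_of_bool) (auto simp: K_def intro: Max_ge)
  \<comment> \<open>Legendre's double count: pairs \<open>(i, k)\<close> with \<open>p ^ k\<close>
    dividing \<open>U i\<close>, summed first over \<open>i\<close>.\<close>
  have vfact: "?v (lucas_fact P Q m) = (\<Sum>k=1..K. card {i\<in>{1..m}. int p ^ k dvd ?U i})"
    if "m \<le> N" for m
  proof -
    have "?v (lucas_fact P Q m) = (\<Sum>i=1..m. ?v (?U i))"
      unfolding lucas_fact_def using nz pe
      by (intro prime_elem_multiplicity_prod_distrib) auto
    also have "\<dots> = (\<Sum>i=1..m. \<Sum>k=1..K. of_bool (int p ^ k dvd ?U i))"
      using that by (intro sum.cong vsum) auto
    also have "\<dots> = (\<Sum>k=1..K. \<Sum>i=1..m. of_bool (int p ^ k dvd ?U i))"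
      by (rule sum.swap)
    also have "\<dots> = (\<Sum>k=1..K. card {i\<in>{1..m}. int p ^ k dvd ?U i})"
      by (intro sum.cong) (simp_all add: Int_def)
    finally show ?thesis .
  qed
  let ?a = "lucas_fact P Q ((l + 1) * n)"
  let ?b = "?U (Suc n) ^ l * lucas_fact P Q n ^ (l + 1)"
  have "?v ?b = l * ?v (?U (Suc n)) + (l + 1) * ?v (lucas_fact P Q n)"
    using pe nz fnz by (simp add: prime_elem_multiplicity_mult_distrib
      prime_elem_multiplicity_power_distrib del: power_Suc)
  also have "\<dots> = (\<Sum>k=1..K. l * of_bool (int p ^ k dvd ?U (Suc n))
      + (l + 1) * card {i\<in>{1..n}. int p ^ k dvd ?U i})"
    by (subst vsum, simp add: N_def, subst vfact, simp add: N_def)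
      (simp only: sum.distrib sum_distrib_left)
  \<comment> \<open>The common cutoff \<open>K\<close> lets the two valuations be compared
    separately for each \<open>k\<close>.\<close>
  also have "\<dots> \<le> (\<Sum>k=1..K. card {i\<in>{1..(l + 1) * n}. int p ^ k dvd ?U i})"
    using assms(4) rank by (intro sum_mono card_prime_power_dvd_lucas_le p) auto
  also have "\<dots> = ?v ?a" by (subst vfact) (simp_all add: N_def)
  finally have "padic_val p (of_int ?a / of_int ?b) \<ge> 0"
    using assms(3) nz fnz by (intro padic_val_divide_nonneg) auto
  also have "of_int ?a / of_int ?b = lucas_C P Q l n"
    by (simp add: lucas_C_def)
  finally show "padic_val p (lucas_C P Q l n) \<ge> 0" .
qed

end
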